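(* For every positive integer $n$ there exists a real quadratic field $K$ such that $n$ is properly $K$-congruent.
   Context: Let $K$ be a number field and let $n$ be a positive integer. We say that $n$ is a $K$-congruent number if there exist $a,b,c\in K$ such that $$a^2+b^2=c^2\qquad\text{and}\qquad \tfrac12 ab=n.$$ A $K$-congruent number $n$ is called properly $K$-congruent if this system has infinitely many solutions $(a,b,c)\in K^3$. A real quadratic field is a subfield of $\mathbb{R}$ of degree $2$ over $\mathbb{Q}$. *)

theory Defs
  imports Complex_Main
begin

definition is_subfield :: "'a::field set \<Rightarrow> bool" where
  "is_subfield K \<longleftrightarrow>
     0 \<in> K \<and> 1 \<in> K \<and>
     (\<forall>x\<in>K. \<forall>y\<in>K. x + y \<in> K \<and> x * y \<in> K) \<and>
     (\<forall>x\<in>K. - x \<in> K) \<and>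
     (\<forall>x\<in>K. x \<noteq> 0 \<longrightarrow> inverse x \<in> K)"

global_interpretation rat_vs:
  vector_space "\<lambda>(q::rat) (x::'a::field_char_0). of_rat q * x"
  defines rat_span = rat_vs.span and rat_degree = rat_vs.dim
  by unfold_locales (simp_all add: algebra_simps of_rat_add of_rat_mult)

definition number_field :: "'a::field_char_0 set \<Rightarrow> bool" where
  "number_field K \<longleftrightarrow> is_subfield K \<and> (\<exists>B. finite B \<and> rat_span B = K)"

text \<open>The library's dimension is \<open>0\<close> for spaces without a finite basis, so
  \<open>rat_degree K = 2\<close> includes that \<open>K\<close> is finite-dimensional over the rationals.\<close>

definition real_quadratic_field :: "real set \<Rightarrow> bool" where
  "real_quadratic_field K \<longleftrightarrow> is_subfield K \<and> rat_degree K = 2"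

lemma of_rat_in_subfield:
  fixes K :: "'a::field_char_0 set"
  assumes "is_subfield K"
  shows "of_rat q \<in> K"
proof -
  have nat: "of_nat m \<in> K" for m
    using assms by (induction m) (auto simp: is_subfield_def)
  have int: "of_int i \<in> K" for i
  proof (cases i)
    case (nonneg m)
    then show ?thesis using nat[of m] by simp
  next
    case (neg m)
    have "- of_nat (Suc m) \<in> K"
      using assms nat[of "Suc m"] unfolding is_subfield_def by blast
    then show ?thesis using neg by simp
  qed
  obtain a b where q: "q = Fract a b" "b > 0"
    by (cases q) auto
  then have "(of_rat q :: 'a) = of_int a * inverse (of_int b)"
    by (simp add: of_rat_rat divide_inverse)
  moreover have "inverse (of_int b) \<in> K"
    using assms int[of b] q(2) unfolding is_subfield_def by auto
  ultimately show ?thesis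
    using assms int[of a] unfolding is_subfield_def by simp
qed

lemma real_quadratic_field_imp_number_field:
  assumes "real_quadratic_field K"
  shows "number_field K"
proof -
  have K: "is_subfield K" "rat_degree K = 2"
    using assms by (auto simp: real_quadratic_field_def)
  obtain B where B: "B \<subseteq> K" "rat_vs.independent B" "K \<subseteq> rat_span B" "card B = rat_degree K"
    using rat_vs.basis_exists[of K] by blast
  have "rat_vs.subspace K"
    using K(1) of_rat_in_subfield[OF K(1)]
    unfolding rat_vs.subspace_def is_subfield_def by blast
  then have "rat_span B = K"
    using B by (metis rat_vs.span_subspace)
  moreover have "finite B"
    using B(4) K(2) by (metis card.infinite zero_neq_numeral)
  ultimately show ?thesis
    using K(1) by (auto simp: number_field_def)
qed

text \<open>The notions below are meant for a positive integer \<open>n\<close> and a number field \<open>K\<close>,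
  given as a subfield of some field of characteristic zero.\<close>

definition congruent_triples :: "'a::field_char_0 set \<Rightarrow> nat \<Rightarrow> ('a \<times> 'a \<times> 'a) set" where
  "congruent_triples K n =
     {(a, b, c). a \<in> K \<and> b \<in> K \<and> c \<in> K \<and> a\<^sup>2 + b\<^sup>2 = c\<^sup>2 \<and> 1 / 2 * a * b = of_nat n}"

definition congruent_number :: "'a::field_char_0 set \<Rightarrow> nat \<Rightarrow> bool" where
  "congruent_number K n \<longleftrightarrow> congruent_triples K n \<noteq> {}"

definition properly_congruent :: "'a::field_char_0 set \<Rightarrow> nat \<Rightarrow> bool" where
  "properly_congruent K n \<longleftrightarrow> congruent_number K n \<and> infinite (congruent_triples K n)"

end

theory Submission
  imports Defs "HOL-Computational_Algebra.Primes"
begin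

text \<open>
  If \<open>(A, B, C)\<close> is a rational right triangle of area \<open>S\<close>, then scaling it by \<open>r = sqrt (n / S)\<close>
  gives a right triangle of area \<open>n\<close> over \<open>\<rat>(r)\<close>. Doubling the corresponding point on the
  congruent number curve of \<open>S\<close> yields another triangle of area \<open>S\<close>; starting from a primitive
  triple, each doubling lowers the 2-adic valuation of the hypotenuse by one, so there are
  infinitely many of them. The triangles \<open>(3, 4, 5)\<close> and \<open>(5, 12, 13)\<close> have areas 6 and 30,
  whose ratio is not a rational square, hence for one of the two the number \<open>r\<close> is irrational.
\<close>

text \<open>In general this is just the rational span of \<open>1\<close> and \<open>r\<close>; it
  is the field generated by \<open>r\<close> once \<open>r\<^sup>2\<close> is rational.\<close>

definition rat_adjoin :: "real \<Rightarrow> real set" where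
  "rat_adjoin r = {of_rat p + of_rat q * r | p q. True}"

lemma rat_adjoinI: "x = of_rat p + of_rat q * r \<Longrightarrow> x \<in> rat_adjoin r"
  by (auto simp: rat_adjoin_def)

lemma rat_mult_in_rat_adjoin:
  assumes "x \<in> \<rat>"
  shows "x * r \<in> rat_adjoin r"
  using assms by (auto elim!: Rats_cases intro: rat_adjoinI[where p = 0])

lemma is_subfield_rat_adjoin:
  assumes "r\<^sup>2 \<in> \<rat>" and "r \<notin> \<rat>"
  shows "is_subfield (rat_adjoin r)"
proof -
  obtain d where d: "r * r = of_rat d"
    using assms(1) by (auto elim: Rats_cases simp: power2_eq_square)
  have inv: "inverse (of_rat p + of_rat q * r) \<in> rat_adjoin r"
    if nz: "of_rat p + of_rat q * r \<noteq> 0" for p q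
  proof -
    \<comment> \<open>The inverse will be the conjugate divided by the rational norm
      \<open>N\<close>, so the conjugate must not vanish. This is where the irrationality of
      \<open>r\<close> enters.\<close>
    have "of_rat p - of_rat q * r \<noteq> 0"
    proof
      assume *: "of_rat p - of_rat q * r = 0"
      show False
      proof (cases "q = 0")
        case True
        then show False using * nz by simp
      next
        case False
        then have "r = of_rat (p / q)"
          using * by (simp add: of_rat_divide field_simps)
        then show False using assms(2) by simp
      qed
    qed
    moreover define N where "N = p * p - q * q * d"
    have N: "of_rat N = (of_rat p + of_rat q * r) * (of_rat p - of_rat q * r)"
      unfolding N_def of_rat_diff of_rat_mult d[symmetric] by (simp add: algebra_simps)
    ultimately have "inverse (of_rat p + of_rat q * r) = (of_rat p - of_rat q * r) / of_rat N"
      using nz unfolding N by (metis divide_inverse inverse_mult_distrib mult.commute mult.left_neutral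
          nonzero_divide_mult_cancel_right)
    also have "\<dots> = of_rat (p / N) + of_rat (- q / N) * r"
      by (simp add: of_rat_divide of_rat_minus diff_divide_distrib)
    finally show ?thesis by (rule rat_adjoinI)
  qed
  have mult: "(of_rat p + of_rat q * r) * (of_rat p' + of_rat q' * r) \<in> rat_adjoin r" for p q p' q'
  proof (rule rat_adjoinI)
    have "(of_rat p + of_rat q * r) * (of_rat p' + of_rat q' * r)
      = of_rat p * of_rat p' + of_rat q * of_rat q' * (r * r)
        + (of_rat p * of_rat q' + of_rat q * of_rat p') * r"
      by (simp add: algebra_simps)
    then show "(of_rat p + of_rat q * r) * (of_rat p' + of_rat q' * r)
      = of_rat (p * p' + q * q' * d) + of_rat (p * q' + q * p') * r"
      by (simp add: of_rat_add of_rat_mult d)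
  qed
  have add: "(of_rat p + of_rat q * r) + (of_rat p' + of_rat q' * r) \<in> rat_adjoin r" for p q p' q'
    by (rule rat_adjoinI[of _ "p + p'" "q + q'"]) (simp add: of_rat_add algebra_simps)
  have minus: "- (of_rat p + of_rat q * r) \<in> rat_adjoin r" for p q
    by (rule rat_adjoinI[of _ "- p" "- q"]) (simp add: of_rat_minus)
  have "0 \<in> rat_adjoin r" "1 \<in> rat_adjoin r"
    using rat_adjoinI[of 0 0 0 r] rat_adjoinI[of 1 1 0 r] by simp_all
  moreover have "\<exists>p q. x = of_rat p + of_rat q * r" if "x \<in> rat_adjoin r" for x
    using that by (auto simp: rat_adjoin_def)
  ultimately show ?thesis
    unfolding is_subfield_def using add mult minus inv by metis
qed

lemma rat_span_pair: "rat_span {1, r} = rat_adjoin r"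
proof -
  have "x \<in> rat_span {1, r} \<longleftrightarrow> x \<in> rat_adjoin r" for x
    by (auto simp: rat_vs.span_insert rat_adjoin_def algebra_simps)
  then show ?thesis by blast
qed

lemma rat_degree_rat_adjoin:
  assumes "r \<notin> \<rat>"
  shows "rat_degree (rat_adjoin r) = 2"
proof -
  have "r \<noteq> 1" using assms by auto
  have "rat_vs.independent {r, 1}"
  proof (rule rat_vs.independent_insertI)
    show "r \<notin> rat_vs.span {1}"
      using assms by (auto simp: rat_vs.span_singleton)
  qed simp
  then have "rat_vs.dim (rat_vs.span {r, 1}) = card {r, 1}"
    by (rule rat_vs.dim_span_eq_card_independent)
  then show ?thesis
    using \<open>r \<noteq> 1\<close> by (simp add: rat_span_pair insert_commute)
qed

lemma real_quadratic_field_rat_adjoin: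
  assumes "r\<^sup>2 \<in> \<rat>" and "r \<notin> \<rat>"
  shows "real_quadratic_field (rat_adjoin r)"
  using assms is_subfield_rat_adjoin rat_degree_rat_adjoin
  by (simp add: real_quadratic_field_def)

text \<open>The triangle \<open>(A, B, C) / (2 ^ k * U)\<close> has area \<open>S\<close>, and its hypotenuse has 2-adic valuation
  \<open>- k\<close>.\<close>

definition dyadic_triangle :: "int \<Rightarrow> nat \<Rightarrow> int \<Rightarrow> int \<Rightarrow> int \<Rightarrow> int \<Rightarrow> bool" where
  "dyadic_triangle S k A B C U \<longleftrightarrow> odd A \<and> even B \<and> odd C \<and> odd U \<and>
     A\<^sup>2 + B\<^sup>2 = C\<^sup>2 \<and> A * B = 2 * S * (2 ^ k * U)\<^sup>2"

text \<open>With \<open>D = 2 ^ k * U\<close> and rational sides \<open>a = A / D\<close>,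
  \<open>b = B / D\<close>, \<open>c = C / D\<close>, the new sides are
  \<open>(a\<^sup>2 - b\<^sup>2) / (2 * c)\<close>,
  \<open>2 * a * b * c / (a\<^sup>2 - b\<^sup>2)\<close> and \<open>(c ^ 4 + 4 * a\<^sup>2 *
  b\<^sup>2) / (2 * c * (a\<^sup>2 - b\<^sup>2))\<close>, over a common denominator. As
  \<open>A\<^sup>2 - B\<^sup>2\<close> and \<open>C\<close> are odd, that denominator gains exactly
  one factor 2, while the new hypotenuse numerator stays odd.\<close>

lemma dyadic_triangle_double:
  assumes "dyadic_triangle S k A B C U"
  shows "dyadic_triangle S (Suc k) ((A\<^sup>2 - B\<^sup>2)\<^sup>2) (4 * A * B * C\<^sup>2)
           (C ^ 4 + 4 * A\<^sup>2 * B\<^sup>2) (C * (A\<^sup>2 - B\<^sup>2) * U)"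
proof -
  have pyth: "A\<^sup>2 + B\<^sup>2 = C\<^sup>2" and area: "A * B = 2 * S * (2 ^ k * U)\<^sup>2"
    using assms by (auto simp: dyadic_triangle_def)
  have "((A\<^sup>2 - B\<^sup>2)\<^sup>2)\<^sup>2 + (4 * A * B * C\<^sup>2)\<^sup>2 = (C ^ 4 + 4 * A\<^sup>2 * B\<^sup>2)\<^sup>2"
  proof -
    \<comment> \<open>Put \<open>x = (A\<^sup>2 - B\<^sup>2)\<^sup>2\<close> and
      \<open>y = 4 * A\<^sup>2 * B\<^sup>2\<close>. Then \<open>C ^ 4 = x + y\<close>, and the claim
      becomes \<open>x\<^sup>2 + 4 * y * (x + y) = (x + 2 * y)\<^sup>2\<close>.\<close>
    have "C ^ 4 = (A\<^sup>2 + B\<^sup>2)\<^sup>2" by (simp add: pyth)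
    then show ?thesis unfolding pyth[symmetric] by algebra
  qed
  moreover have "(A\<^sup>2 - B\<^sup>2)\<^sup>2 * (4 * A * B * C\<^sup>2)
      = 2 * S * (2 ^ Suc k * (C * (A\<^sup>2 - B\<^sup>2) * U))\<^sup>2"
  proof -
    have "(A\<^sup>2 - B\<^sup>2)\<^sup>2 * (4 * A * B * C\<^sup>2) = (A\<^sup>2 - B\<^sup>2)\<^sup>2 * 4 * C\<^sup>2 * (A * B)"
      by (simp add: algebra_simps)
    then show ?thesis
      unfolding area by (simp add: power_mult_distrib)
  qed
  ultimately show ?thesis
    using assms by (auto simp: dyadic_triangle_def)
qed

lemma dyadic_triangle_exists:
  assumes "dyadic_triangle S 0 A B C U"
  shows "\<exists>A B C U. dyadic_triangle S k A B C U"
proof (induction k)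
  case 0
  then show ?case using assms by blast
next
  case (Suc k)
  then show ?case using dyadic_triangle_double by blast
qed

lemma odd_times_pow2_eq_imp_eq:
  fixes x y :: int
  assumes "odd x" "odd y" "2 ^ j * x = 2 ^ k * y"
  shows "j = k"
proof -
  have "multiplicity 2 (2 ^ i * z) = i" if "odd z" for i and z :: int
    using that by (intro multiplicity_eqI) auto
  then show ?thesis using assms by metis
qed

text \<open>Scaling the sides by \<open>r\<close> turns area \<open>S\<close> into
  \<open>S * r\<^sup>2 = n\<close>. Triangles with different \<open>k\<close> stay different,
  because their hypotenuses divided by \<open>r\<close> have different 2-adic valuations.\<close>

lemma infinite_congruent_triples_rat_adjoin:
  fixes r :: real
  assumes base: "dyadic_triangle S 0 A B C U"
    and r: "r \<noteq> 0" "of_int S * r\<^sup>2 = of_nat n"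
  shows "infinite (congruent_triples (rat_adjoin r) n)"
proof -
  have "\<forall>k. \<exists>A B C U. dyadic_triangle S k A B C U"
    using dyadic_triangle_exists[OF base] by blast
  \<comment> \<open>The chosen triangles need not be successive doublings of each other; the
    valuation of the hypotenuse alone separates them.\<close>
  then obtain a b c u where T: "dyadic_triangle S k (a k) (b k) (c k) (u k)" for k
    by metis
  define f where "f k = (of_int (a k) / (2 ^ k * of_int (u k)) * r,
    of_int (b k) / (2 ^ k * of_int (u k)) * r, of_int (c k) / (2 ^ k * of_int (u k)) * r)" for k
  have nz: "u k \<noteq> 0" for k
    using T[of k] by (auto simp: dyadic_triangle_def)
  have "f k \<in> congruent_triples (rat_adjoin r) n" for k
  proof -
    define D :: real where "D = 2 ^ k * of_int (u k)"
    have D: "D \<noteq> 0" "D \<in> \<rat>" using nz[of k] by (auto simp: D_def)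
    have "of_int ((a k)\<^sup>2 + (b k)\<^sup>2) = (of_int ((c k)\<^sup>2) :: real)"
      using T[of k] by (simp add: dyadic_triangle_def)
    then have "(of_int (a k))\<^sup>2 + (of_int (b k))\<^sup>2 = (of_int (c k) :: real)\<^sup>2"
      by simp
    then have "(of_int (a k) / D * r)\<^sup>2 + (of_int (b k) / D * r)\<^sup>2 = (of_int (c k) / D * r)\<^sup>2"
      by (simp add: power_mult_distrib power_divide flip: add_divide_distrib distrib_right)
    moreover have "1 / 2 * (of_int (a k) / D * r) * (of_int (b k) / D * r) = of_nat n"
    proof -
      have "of_int (a k * b k) = (of_int (2 * S * (2 ^ k * u k)\<^sup>2) :: real)"
        using T[of k] by (simp add: dyadic_triangle_def)
      then have "of_int (a k) * of_int (b k) = 2 * of_int S * D\<^sup>2"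
        by (simp add: D_def)
      then have "1 / 2 * (of_int (a k) / D * r) * (of_int (b k) / D * r) = of_int S * r\<^sup>2"
        using D by (simp add: field_simps power2_eq_square)
      then show ?thesis using r(2) by simp
    qed
    moreover have "of_int z / D * r \<in> rat_adjoin r" for z
      using D(2) by (intro rat_mult_in_rat_adjoin) simp
    ultimately show ?thesis
      unfolding congruent_triples_def f_def D_def[symmetric] by blast
  qed
  moreover have "inj f"
  proof (rule injI)
    fix j k assume "f j = f k"
    then have "of_int (c j) / (2 ^ j * of_int (u j)) = (of_int (c k) / (2 ^ k * of_int (u k)) :: real)"
      using r(1) unfolding f_def prod.inject mult_cancel_right by blast
    \<comment> \<open>Clearing denominators leaves powers of 2 times odd integers, so the exponents
      can be compared.\<close>
    then have "of_int (2 ^ k * (c j * u k)) = (of_int (2 ^ j * (c k * u j)) :: real)"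
      using nz[of j] nz[of k] by (simp add: field_simps)
    then have "2 ^ k * (c j * u k) = 2 ^ j * (c k * u j)"
      unfolding of_int_eq_iff .
    moreover have "odd (c j * u k)" "odd (c k * u j)"
      using T[of j] T[of k] by (auto simp: dyadic_triangle_def)
    ultimately show "j = k"
      using odd_times_pow2_eq_imp_eq by metis
  qed
  ultimately show ?thesis
    unfolding infinite_iff_countable_subset by blast
qed

text \<open>Here 5 is the ratio of the areas 30 and 6 of the two starting triangles. The proof is
  the classical one: 5 would divide both terms of a reduced fraction.\<close>

lemma sqrt_5_irrational: "sqrt 5 \<notin> \<rat>"
proof
  assume "sqrt 5 \<in> \<rat>"
  then obtain m k :: nat where k: "k \<noteq> 0" and mk: "\<bar>sqrt 5\<bar> = real m / real k" and "coprime m k"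
    by (rule Rats_abs_nat_div_natE)
  then have "real (m\<^sup>2) = real (5 * k\<^sup>2)"
    by (auto simp: field_simps power_mult_distrib dest: arg_cong[where f = power2])
  then have eq: "m\<^sup>2 = 5 * k\<^sup>2" by linarith
  have "prime (5 :: nat)" by simp
  then have "5 dvd m" using eq by (metis dvd_triv_left prime_dvd_power)
  then obtain l where "m = 5 * l" ..
  with eq have "k\<^sup>2 = 5 * l\<^sup>2" by (simp add: power_mult_distrib)
  then have "5 dvd k" using \<open>prime 5\<close> by (metis dvd_triv_left prime_dvd_power)
  with \<open>5 dvd m\<close> \<open>coprime m k\<close> have "is_unit (5 :: nat)" by (metis coprime_common_divisor)
  then show False by simp
qed

theorem theorem1:
  fixes n :: nat
  assumes "n > 0"
  shows "\<exists>K :: real set. real_quadratic_field K \<and> properly_congruent K n"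
proof -
  \<comment> \<open>A starting triangle of area \<open>S\<close> settles the theorem whenever
    \<open>n / S\<close> is not a rational square: the scaling factor then generates a quadratic
    field.\<close>
  have scaled: ?thesis
    if "dyadic_triangle S 0 A B C U" "S > 0" "sqrt (real n / of_int S) \<notin> \<rat>" for S A B C U
  proof -
    define r where "r = sqrt (real n / of_int S)"
    have r2: "r\<^sup>2 = real n / of_int S" using that(2) by (simp add: r_def)
    have "infinite (congruent_triples (rat_adjoin r) n)"
      using infinite_congruent_triples_rat_adjoin[OF that(1), of r n] that(2) assms
      by (simp add: r2) (simp add: r_def)
    then have "properly_congruent (rat_adjoin r) n"
      by (auto simp: properly_congruent_def congruent_number_def)
    moreover have "real_quadratic_field (rat_adjoin r)"
      using that(3) by (intro real_quadratic_field_rat_adjoin) (auto simp: r2, simp add: r_def)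
    ultimately show ?thesis by blast
  qed
  \<comment> \<open>If both roots were rational, so would be their quotient, from which
    \<open>n\<close> cancels.\<close>
  have "sqrt (real n / 6) \<notin> \<rat> \<or> sqrt (real n / 30) \<notin> \<rat>"
  proof (rule ccontr)
    assume "\<not> ?thesis"
    then have "sqrt (real n / 6) / sqrt (real n / 30) \<in> \<rat>" by simp
    also have "sqrt (real n / 6) / sqrt (real n / 30) = sqrt 5"
      using assms by (simp flip: real_sqrt_divide)
    finally show False using sqrt_5_irrational by contradiction
  qed
  then show ?thesis
  proof
    assume "sqrt (real n / 6) \<notin> \<rat>"
    \<comment> \<open>The integer triangle itself is the case \<open>k = 0\<close>,
      \<open>U = 1\<close>; the odd leg has to come first.\<close>
    then show ?thesis by (intro scaled[of 6 3 4 5 1]) (auto simp: dyadic_triangle_def)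
  next
    assume "sqrt (real n / 30) \<notin> \<rat>"
    then show ?thesis by (intro scaled[of 30 5 12 13 1]) (auto simp: dyadic_triangle_def)
  qed
qed

end
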